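(* Let $a>\sqrt2$ be a fixed real number. For integers $n\ge 4$ such that $a>\sqrt{2}\cdot(3\sqrt{n})^{1/n}$, let $\widetilde{\rho}_{n}(a;x)$ be a logarithmic derivative which is least deviating from zero on $I=[-1;1]$ in the norm $\|\cdot\|$ among all those belonging to $\mathfrak{R}_n(a)$. Then $$\|\widetilde{\rho}_{n}(a;\cdot)\| \asymp \frac{2n}{T_n(a)-T_{n-2}(a)},$$ i.e. there exist constants $0<\alpha\le\beta<\infty$ such that for all such $n$ the ratio of the left-hand side to the right-hand side lies in $[\alpha,\beta]$. Moreover, as $n\to \infty$ the sign $\asymp$ can be replaced by $\sim$, i.e. the ratio of the two sides tends to $1$.
   Context: A logarithmic derivative (l.d.) of degree $m\ge 1$ is a rational function $\rho(z)=P'(z)/P(z)=\sum_{k=1}^m \frac{1}{z-z_k}$, where $P(z)=\prod_{k=1}^m (z-z_k)$, $z_k\in\mathbb{C}$ (repetitions allowed); the l.d. of degree $0$ is $\rho\equiv 0$. Only real-valued l.d.s are considered, i.e. the multiset $\{z_k\}$ is symmetric with respect to the real line. For real $a$, $\mathfrak{R}_n(a)$ is the class of all real-valued l.d.s of degree less than or equal to $n$ that have the fixed pole $x=a$ (one of the $z_k$ equals $a$). Let $I:=[-1;1]$ and $\|\rho\|:=\max_{x\in I}|\rho(x)|$, understood as $+\infty$ if $\rho$ has a pole on $I$. An l.d. $\widetilde\rho\in\mathfrak{R}_n(a)$ is least deviating from zero in the norm $\|\cdot\|$ among those in $\mathfrak{R}_n(a)$ if $\|\widetilde\rho\|\le\|\rho\|$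 for all $\rho\in\mathfrak{R}_n(a)$. $T_n(x)=\cos (n\arccos x)$ is the Chebyshev polynomial of the first kind. *)

theory Defs
  imports
    Complex_Main
    "HOL-Library.Multiset"
    "HOL-Library.Extended_Real"
    "HOL-Computational_Algebra.Polynomial"
begin

text \<open>
  A logarithmic derivative is represented by the multiset \<open>Z\<close> of its poles, i.e. of the roots
  of the monic polynomial \<open>P\<close> with \<open>\<rho> = P' / P\<close>; the degree is \<open>size Z\<close>.  All residues
  are positive, so poles never cancel.  The value of \<open>log_deriv Z\<close> is meaningful only off \<open>Z\<close>.
\<close>

definition log_deriv :: "complex multiset \<Rightarrow> complex \<Rightarrow> complex" where
  "log_deriv Z z = (\<Sum>w\<in>#Z. 1 / (z - w))"

lemma log_deriv_eq_pderiv_div: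
  fixes Z :: "complex multiset"
  defines "P \<equiv> (\<Prod>w\<in>#Z. [:-w, 1:])"
  assumes "z \<notin># Z"
  shows "log_deriv Z z = poly (pderiv P) z / poly P z"
proof -
  have "poly (\<Prod>w\<in>#Z. [:-w, 1:]) z \<noteq> 0 \<and>
        log_deriv Z z = poly (pderiv (\<Prod>w\<in>#Z. [:-w, 1:])) z / poly (\<Prod>w\<in>#Z. [:-w, 1:]) z"
    using assms(2)
  proof (induction Z)
    case empty
    then show ?case by (simp add: log_deriv_def)
  next
    case (add w Z)
    then have "z \<noteq> w" "z \<notin># Z" by auto
    define Q where "Q = (\<Prod>w\<in>#Z. [:-w, 1:])"
    have Q: "poly Q z \<noteq> 0" "log_deriv Z z = poly (pderiv Q) z / poly Q z"
      using add.IH[OF \<open>z \<notin># Z\<close>] by (simp_all add: Q_def)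
    have "pderiv [:-w, 1:] = 1" by (simp add: pderiv_pCons)
    then have "poly (pderiv ([:-w, 1:] * Q)) z = (z - w) * poly (pderiv Q) z + poly Q z"
      unfolding pderiv_mult by (simp add: algebra_simps)
    moreover have "poly ([:-w, 1:] * Q) z = (z - w) * poly Q z"
      by (simp add: algebra_simps)
    moreover have "log_deriv (add_mset w Z) z = 1 / (z - w) + log_deriv Z z"
      by (simp add: log_deriv_def)
    moreover have "(\<Prod>w\<in>#add_mset w Z. [:-w, 1:]) = [:-w, 1:] * Q"
      by (simp add: Q_def)
    ultimately show ?case
      using Q \<open>z \<noteq> w\<close> by (simp only: Q(2)) (simp add: field_simps)
  qed
  then show ?thesis by (simp add: P_def)
qed

text \<open>Real-valuedness is symmetry of the pole multiset with respect to the real line.\<close>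

definition log_deriv_class :: "nat \<Rightarrow> real \<Rightarrow> complex multiset set" where
  "log_deriv_class n a =
     {Z. size Z \<le> n \<and> image_mset cnj Z = Z \<and> complex_of_real a \<in># Z}"

text \<open>
  Without poles on \<open>[-1, 1]\<close> the supremum is a maximum, by continuity and compactness.
\<close>

definition log_deriv_norm :: "complex multiset \<Rightarrow> ereal" where
  "log_deriv_norm Z =
     (if \<exists>x\<in>{-1..1::real}. complex_of_real x \<in># Z then \<infinity>
      else (SUP x\<in>{-1..1::real}. ereal (cmod (log_deriv Z (complex_of_real x)))))"

definition least_deviating :: "nat \<Rightarrow> real \<Rightarrow> complex multiset \<Rightarrow> bool" where
  "least_deviating n a Z \<longleftrightarrow>
     Z \<in> log_deriv_class n a \<and>
     (\<forall>W\<in>log_deriv_class n a. log_deriv_norm Z \<le> log_deriv_norm W)"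

text \<open>
  The formula \<open>cos (n arccos x)\<close> determines the Chebyshev polynomial through its values on
  \<open>[-1, 1]\<close>; its values at other points are those of the polynomial.
\<close>

definition Chebyshev_T :: "nat \<Rightarrow> real poly" where
  "Chebyshev_T n = (THE p. \<forall>x\<in>{-1..1}. poly p x = cos (real n * arccos x))"

lemma Chebyshev_T_ex:
  "\<exists>p :: real poly. \<forall>x\<in>{-1..1}. poly p x = cos (real n * arccos x)"
proof (induction n rule: less_induct)
  case (less n)
  consider "n = 0" | "n = 1" | m where "n = Suc (Suc m)"
    by (metis One_nat_def not0_implies_Suc)
  then show ?case
  proof cases
    case 1
    then show ?thesis by (intro exI[of _ 1]) simp
  next
    case 2
    then show ?thesis by (intro exI[of _ "[:0, 1:]"]) (simp add: cos_arccos)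
  next
    case (3 m)
    obtain p q :: "real poly"
      where p: "\<forall>x\<in>{-1..1}. poly p x = cos (real m * arccos x)"
        and q: "\<forall>x\<in>{-1..1}. poly q x = cos (real (Suc m) * arccos x)"
      using less.IH[of m] less.IH[of "Suc m"] 3 by auto
    have "poly ([:0, 2:] * q - p) x = cos (real n * arccos x)" if x: "x \<in> {-1..1}" for x
    proof -
      define t where "t = arccos x"
      have "cos t = x" using x by (simp add: t_def cos_arccos)
      moreover have "cos (real n * t) + cos (real m * t) = 2 * cos t * cos (real (Suc m) * t)"
      proof -
        have "real n * t = real (Suc m) * t + t" "real m * t = real (Suc m) * t - t"
          using 3 by (simp_all add: algebra_simps)
        then show ?thesis by (simp only: cos_add cos_diff) simp
      qed
      ultimately show ?thesis using p q x by (simp add: t_def)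
    qed
    then show ?thesis by blast
  qed
qed

lemma Chebyshev_T_ex1:
  "\<exists>!p :: real poly. \<forall>x\<in>{-1..1}. poly p x = cos (real n * arccos x)"
proof (rule ex_ex1I[OF Chebyshev_T_ex])
  fix p q :: "real poly"
  assume "\<forall>x\<in>{-1..1}. poly p x = cos (real n * arccos x)"
    and "\<forall>x\<in>{-1..1}. poly q x = cos (real n * arccos x)"
  then have "{-1..1} \<subseteq> {x. poly (p - q) x = 0}" by auto
  then have "infinite {x. poly (p - q) x = 0}"
    by (rule infinite_super) (simp add: infinite_Icc)
  then show "p = q" using poly_roots_finite[of "p - q"] by auto
qed

lemma poly_Chebyshev_T:
  "x \<in> {-1..1} \<Longrightarrow> poly (Chebyshev_T n) x = cos (real n * arccos x)"
  unfolding Chebyshev_T_def using theI'[OF Chebyshev_T_ex1[of n]] by blast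

end

theory Submission
  imports
    Defs
    "HOL-Computational_Algebra.Fundamental_Theorem_Algebra"
    "HOL-Real_Asymp.Real_Asymp"
begin

text \<open>
  Let \<open>n = m + 2\<close> and let \<open>P\<close> be the polynomial with \<open>\<rho> = P' / P\<close>; it is real and vanishes
  at \<open>a\<close>.  If \<open>\<rho>\<close> is small on \<open>[-1, 1]\<close>, then \<open>P\<close> is almost constant there, and minimising
  \<open>\<rho>\<close> becomes a linear problem: how small can \<open>P'\<close> be on \<open>[-1, 1]\<close> if \<open>P\<close> has to fall from \<open>1\<close>
  at the point \<open>1\<close> to \<open>0\<close> at \<open>a\<close>?  Among the polynomials of degree at most \<open>n - 1\<close> that
  are bounded by \<open>1\<close> on \<open>[-1, 1]\<close>, the Chebyshev polynomial \<open>T\<^bsub>n-1\<^esub>\<close> grows fastest to the right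
  of \<open>1\<close> (\<open>Chebyshev_T_dominates\<close>), and it has the explicit antiderivative
  \<open>(T\<^bsub>n\<^esub> / n - T\<^bsub>n-2\<^esub> / (n - 2)) / 2\<close> (\<open>pderiv_Chebyshev_T_diff\<close>).

  Lower bound.  If \<open>\<bar>P'\<bar> \<le> \<epsilon> \<bar>P\<bar>\<close> on \<open>[-1, 1]\<close>, then \<open>\<bar>P\<bar> \<le> exp (2 \<epsilon>) \<bar>P 1\<bar>\<close> there
  (\<open>abs_le_of_log_deriv_bound\<close>), so to the right of \<open>1\<close> the derivative is at most
  \<open>\<epsilon> exp (2 \<epsilon>) \<bar>P 1\<bar> T\<^bsub>n-1\<^esub>\<close>.  Integrating from \<open>1\<close> to \<open>a\<close> gives \<open>\<mu> \<le> \<epsilon> exp (2 \<epsilon>)\<close>, where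
  \<open>\<mu> = 2 n / (T\<^bsub>n\<^esub>(a) - T\<^bsub>n-2\<^esub>(a))\<close> (\<open>log_deriv_lower_bound\<close>).

  Upper bound.  With \<open>S = T\<^bsub>n\<^esub> / n - T\<^bsub>n-2\<^esub> / (n - 2)\<close>, the polynomial \<open>S(a) - S\<close> vanishes at \<open>a\<close>,
  has derivative \<open>-2 T\<^bsub>n-1\<^esub>\<close>, and on \<open>[-1, 1]\<close> is at least \<open>S(a)\<close> minus a bounded quantity.  Its
  logarithmic derivative is a competitor whose norm is \<open>\<mu> (1 + o(1))\<close>
  (\<open>least_deviating_norm_le_Chebyshev\<close>).

  Since \<open>T\<^bsub>n\<^esub>(a)\<close> grows exponentially, \<open>\<mu>\<close> tends to \<open>0\<close>, so the factor \<open>exp (2 \<epsilon>)\<close> tends to \<open>1\<close>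
  and both bounds are asymptotically equal.  For the small \<open>n\<close> for which the Chebyshev
  competitor is of no use, the single pole at \<open>a\<close> gives the bound \<open>1 / (a - 1)\<close>
  (\<open>least_deviating_norm_le_linear\<close>); this suffices for the two constants.
\<close>

section \<open>Chebyshev polynomials off the interval\<close>

lemma Chebyshev_T_eqI:
  assumes "\<And>x. x \<in> {-1..1} \<Longrightarrow> poly p x = cos (real n * arccos x)"
  shows "Chebyshev_T n = p"
  using assms Chebyshev_T_ex1[of n] poly_Chebyshev_T[of _ n] by metis

lemma Chebyshev_T_0: "Chebyshev_T 0 = 1"
  by (rule Chebyshev_T_eqI) simp

lemma Chebyshev_T_1: "Chebyshev_T (Suc 0) = [:0, 1:]"
  by (rule Chebyshev_T_eqI) (simp add: cos_arccos)

lemma Chebyshev_T_Suc_Suc: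
  "Chebyshev_T (Suc (Suc n)) = [:0, 2:] * Chebyshev_T (Suc n) - Chebyshev_T n"
proof (rule Chebyshev_T_eqI)
  fix x :: real assume x: "x \<in> {-1..1}"
  define t where "t = arccos x"
  have x_cos: "x = cos t" using x by (simp add: t_def cos_arccos)
  have "cos (real (Suc (Suc n)) * t) + cos (real n * t) = 2 * cos t * cos (real (Suc n) * t)"
  proof -
    have "real (Suc (Suc n)) * t = real (Suc n) * t + t" "real n * t = real (Suc n) * t - t"
      by (simp_all add: algebra_simps)
    then show ?thesis by (simp only: cos_add cos_diff) simp
  qed
  then show "poly ([:0, 2:] * Chebyshev_T (Suc n) - Chebyshev_T n) x
      = cos (real (Suc (Suc n)) * arccos x)"
    using x by (simp add: poly_Chebyshev_T flip: t_def x_cos)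
qed

lemma degree_Chebyshev_T_le: "degree (Chebyshev_T n) \<le> n"
proof (induction n rule: induct_nat_012)
  case (ge2 n)
  have "degree ([:0, 2:] * Chebyshev_T (Suc n)) \<le> Suc (Suc n)"
    using degree_mult_le[of "[:0, 2:]" "Chebyshev_T (Suc n)"] ge2 by simp
  then show ?case
    using ge2 by (simp add: Chebyshev_T_Suc_Suc degree_diff_le)
qed (simp_all add: Chebyshev_T_0 Chebyshev_T_1)

text \<open>
  The hyperbolic counterpart of the cosine formula: it gives the values to the right of \<open>1\<close>,
  where both the pole \<open>a\<close> and the growth of the polynomials are studied.
\<close>

lemma poly_Chebyshev_T_cosh:
  fixes t :: real
  shows "poly (Chebyshev_T n) (cosh t) = cosh (real n * t)"
proof (induction n rule: induct_nat_012)
  case (ge2 n)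
  have *: "real (Suc (Suc n)) * t = real (Suc n) * t + t" "real n * t = real (Suc n) * t - t"
    by (simp_all add: algebra_simps)
  have "cosh (real (Suc (Suc n)) * t) + cosh (real n * t) = 2 * cosh t * cosh (real (Suc n) * t)"
    unfolding * by (simp only: cosh_add cosh_diff) simp
  then show ?case
    using ge2 by (simp add: Chebyshev_T_Suc_Suc)
qed (simp_all add: Chebyshev_T_0 Chebyshev_T_1)

lemma poly_Chebyshev_T_arcosh:
  assumes "x \<ge> 1"
  shows "poly (Chebyshev_T n) x = cosh (real n * arcosh x)"
  using poly_Chebyshev_T_cosh[of n "arcosh x"] assms by (simp add: cosh_arcosh_real)

lemma Chebyshev_T_ge_1:
  assumes "x \<ge> 1"
  shows "poly (Chebyshev_T n) x \<ge> 1"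
  by (simp add: poly_Chebyshev_T_arcosh[OF assms] cosh_real_ge_1)

lemma Chebyshev_T_at_1: "poly (Chebyshev_T n) 1 = 1"
  by (simp add: poly_Chebyshev_T)

lemma abs_Chebyshev_T_le_1:
  assumes "x \<in> {-1..1}"
  shows "\<bar>poly (Chebyshev_T n) x\<bar> \<le> 1"
  using assms by (simp add: poly_Chebyshev_T)

text \<open>
  After the substitution \<open>x = cosh t\<close> this is
  \<open>sinh ((m + 2) t) - sinh (m t) = 2 cosh ((m + 1) t) sinh t\<close>; an identity between polynomials
  follows because it holds at the infinitely many points \<open>x > 1\<close>.
\<close>

lemma pderiv_Chebyshev_T_diff:
  assumes "m \<ge> 1"
  shows "pderiv (smult (1 / real (m + 2)) (Chebyshev_T (m + 2)) - smult (1 / real m) (Chebyshev_T m))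
       = smult 2 (Chebyshev_T (m + 1))" (is "pderiv ?S = ?T")
proof -
  have eq: "poly (pderiv ?S) (cosh t) = poly ?T (cosh t)" if "t > 0" for t :: real
  proof -
    have cosh_deriv: "((\<lambda>t. cosh (c * t) / c) has_real_derivative sinh (c * t)) (at t)"
      if "c \<noteq> 0" for c :: real
      using that by (auto intro!: derivative_eq_intros)
    have "((\<lambda>t. poly ?S (cosh t)) has_real_derivative poly (pderiv ?S) (cosh t) * sinh t) (at t)"
      by (rule DERIV_chain2[OF poly_DERIV]) (auto intro!: derivative_eq_intros)
    moreover have "((\<lambda>t. poly ?S (cosh t))
        has_real_derivative (sinh (real (m + 2) * t) - sinh (real m * t))) (at t)"
      using DERIV_diff[OF cosh_deriv[of "real (m + 2)"] cosh_deriv[of "real m"]] assms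
      by (simp add: poly_Chebyshev_T_cosh)
    ultimately have "poly (pderiv ?S) (cosh t) * sinh t = sinh (real (m + 2) * t) - sinh (real m * t)"
      by (rule DERIV_unique)
    also have "\<dots> = 2 * cosh (real (m + 1) * t) * sinh t"
    proof -
      have *: "real (m + 2) * t = real (m + 1) * t + t" "real m * t = real (m + 1) * t - t"
        by (simp_all add: algebra_simps)
      show ?thesis unfolding * by (simp only: sinh_add sinh_diff)
    qed
    finally show ?thesis
      using that poly_Chebyshev_T_cosh[of "m + 1" t] by simp
  qed
  have "{1<..} \<subseteq> {x. poly (pderiv ?S - ?T) x = 0}"
  proof
    fix x :: real assume "x \<in> {1<..}"
    then have "x = cosh (arcosh x)" "arcosh x > 0"
      by simp_all
    then show "x \<in> {x. poly (pderiv ?S - ?T) x = 0}"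
      using eq[of "arcosh x"] by simp
  qed
  then have "infinite {x. poly (pderiv ?S - ?T) x = 0}"
    using infinite_super infinite_Ioi by blast
  then show ?thesis
    using poly_roots_finite[of "pderiv ?S - ?T"] by auto
qed

text \<open>
  Chebyshev's alternation argument.  If \<open>q\<close> exceeded \<open>M T\<^bsub>m\<^esub>\<close> at \<open>x\<close>, scale \<open>T\<^bsub>m\<^esub>\<close> by the factor \<open>c > M\<close>
  that makes it agree with \<open>q\<close> at \<open>x\<close>.  The difference \<open>c T\<^bsub>m\<^esub> - q\<close> then has the alternating signs of
  \<open>T\<^bsub>m\<^esub>\<close> at the \<open>m + 1\<close> extremal points \<open>cos (k \<pi> / m)\<close>, hence \<open>m\<close> zeros between them; together with \<open>x\<close>
  these are too many for its degree.
\<close>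

lemma Chebyshev_T_dominates_one_sided:
  fixes q :: "real poly"
  assumes deg: "degree q \<le> m" and bound: "\<And>x. x \<in> {-1..1} \<Longrightarrow> \<bar>poly q x\<bar> \<le> M" and "x \<ge> 1"
  shows "poly q x \<le> M * poly (Chebyshev_T m) x"
proof (rule ccontr)
  assume "\<not> ?thesis"
  then have less: "M * poly (Chebyshev_T m) x < poly q x" by simp
  have Tx: "poly (Chebyshev_T m) x \<ge> 1" by (rule Chebyshev_T_ge_1) fact
  define c where "c = poly q x / poly (Chebyshev_T m) x"
  have "c > M" using less Tx by (simp add: c_def field_simps)
  define r where "r = smult c (Chebyshev_T m) - q"
  have r_x: "poly r x = 0" using Tx by (simp add: r_def c_def)
  have deg_r: "degree r \<le> m"
    using deg degree_Chebyshev_T_le[of m] by (auto simp: r_def intro!: degree_diff_le)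
  define z where "z k = cos (real k * pi / real m)" for k
  have z_range: "z k \<in> {-1..1}" for k by (simp add: z_def)
  have z_less: "z j < z i" if "i < j" "j \<le> m" for i j
  proof -
    have "real i * pi / real m < real j * pi / real m" "real j * pi / real m \<le> pi"
      using that by (simp_all add: field_simps)
    then show ?thesis unfolding z_def by (intro cos_monotone_0_pi) auto
  qed
  have T_z: "poly (Chebyshev_T m) (z k) = (-1) ^ k" if "k \<le> m" for k
  proof (cases "m = 0")
    case True
    then show ?thesis using that by (simp add: Chebyshev_T_0)
  next
    case False
    have "real k * pi / real m \<le> pi" "0 \<le> real k * pi / real m"
      using that False by (simp_all add: field_simps)
    then have "arccos (z k) = real k * pi / real m"
      unfolding z_def by (intro arccos_cos) auto
    then show ?thesis
      using z_range[of k] False by (simp add: poly_Chebyshev_T cos_npi)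
  qed
  have sign: "(-1) ^ k * poly r (z k) > 0" if "k \<le> m" for k
  proof -
    have "(-1) ^ k * poly r (z k) = c - (-1) ^ k * poly q (z k)"
      using T_z[OF that] by (simp add: r_def algebra_simps flip: power_add mult_2)
    moreover have "\<bar>(-1) ^ k * poly q (z k)\<bar> \<le> M"
      using bound[OF z_range] by (simp add: abs_mult)
    ultimately show ?thesis using \<open>c > M\<close> by linarith
  qed
  then have "r \<noteq> 0" using sign[of 0] by auto
  have "\<exists>y. z (Suc k) < y \<and> y < z k \<and> poly r y = 0" if "k < m" for k
  proof -
    have "poly r (z (Suc k)) * poly r (z k) < 0"
      using sign[of k] sign[of "Suc k"] that
      by (cases "even k") (auto simp: mult_less_0_iff)
    then show ?thesis
      using poly_IVT[of "z (Suc k)" "z k" r] z_less[of k "Suc k"] that by auto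
  qed
  then obtain y where y: "\<And>k. k < m \<Longrightarrow> z (Suc k) < y k \<and> y k < z k \<and> poly r (y k) = 0"
    by metis
  have y_less: "y j < y i" if "i < j" "j < m" for i j
  proof -
    have "z j \<le> z (Suc i)"
      using that z_less[of "Suc i" j] by (cases "Suc i = j") auto
    then show ?thesis using y[of i] y[of j] that by force
  qed
  have "inj_on y {..<m}"
    by (rule linorder_inj_onI) (use y_less in force)+
  moreover have "x \<notin> y ` {..<m}"
  proof
    assume "x \<in> y ` {..<m}"
    then obtain k where "k < m" "x = y k" by auto
    then show False using y[of k] z_range[of k] \<open>x \<ge> 1\<close> by auto
  qed
  ultimately have "card (insert x (y ` {..<m})) = Suc m"
    by (simp add: card_image)
  moreover have "insert x (y ` {..<m}) \<subseteq> {x. poly r x = 0}"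
    using y r_x by auto
  ultimately have "Suc m \<le> card {x. poly r x = 0}"
    using card_mono[OF poly_roots_finite[OF \<open>r \<noteq> 0\<close>]] by metis
  also have "\<dots> \<le> degree r"
    by (rule card_poly_roots_bound) fact
  finally show False using deg_r by simp
qed

lemma Chebyshev_T_dominates:
  fixes q :: "real poly"
  assumes "degree q \<le> m" and "\<And>x. x \<in> {-1..1} \<Longrightarrow> \<bar>poly q x\<bar> \<le> M" and "x \<ge> 1"
  shows "\<bar>poly q x\<bar> \<le> M * poly (Chebyshev_T m) x"
  using Chebyshev_T_dominates_one_sided[of q m M x] Chebyshev_T_dominates_one_sided[of "-q" m M x] assms
  by (simp add: abs_le_iff)

lemma Chebyshev_T_gap_pos:
  assumes "a > 1"
  shows "poly (Chebyshev_T m) a < poly (Chebyshev_T (m + 2)) a"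
  using assms by (simp add: poly_Chebyshev_T_arcosh cosh_real_nonneg_less_iff)

section \<open>The lower bound\<close>

text \<open>
  The differential inequality makes \<open>(p x)\<^sup>2 exp (2 \<epsilon> x)\<close> nondecreasing.  Working with the square of \<open>p\<close>
  avoids logarithms and any discussion of the sign of \<open>p\<close>.
\<close>

lemma abs_le_of_log_deriv_bound:
  fixes p :: "real poly"
  assumes bound: "\<And>x. x \<in> {-1..1} \<Longrightarrow> \<bar>poly (pderiv p) x\<bar> \<le> \<epsilon> * \<bar>poly p x\<bar>"
    and x: "x \<in> {-1..1}" and "\<epsilon> \<ge> 0"
  shows "\<bar>poly p x\<bar> \<le> exp (2 * \<epsilon>) * \<bar>poly p 1\<bar>"
proof -
  define g where "g x = (poly p x)\<^sup>2 * exp (2 * \<epsilon> * x)" for x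
  have "g x \<le> g 1"
  proof (rule DERIV_nonneg_imp_nondecreasing[where f = g])
    fix u assume u: "x \<le> u" "u \<le> 1"
    have "\<bar>poly p u\<bar> * \<bar>poly (pderiv p) u\<bar> \<le> \<bar>poly p u\<bar> * (\<epsilon> * \<bar>poly p u\<bar>)"
      using bound[of u] u x by (intro mult_left_mono) auto
    then have "\<bar>poly p u * poly (pderiv p) u\<bar> \<le> \<epsilon> * (poly p u)\<^sup>2"
      by (simp add: abs_mult power2_eq_square algebra_simps)
    then have "0 \<le> 2 * (poly p u * poly (pderiv p) u + \<epsilon> * (poly p u)\<^sup>2) * exp (2 * \<epsilon> * u)"
      by (intro mult_nonneg_nonneg) auto
    moreover have "(g has_real_derivative
        2 * (poly p u * poly (pderiv p) u + \<epsilon> * (poly p u)\<^sup>2) * exp (2 * \<epsilon> * u)) (at u)"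
      unfolding g_def
      by (auto intro!: derivative_eq_intros poly_DERIV simp: algebra_simps)
    ultimately show "\<exists>y. (g has_real_derivative y) (at u) \<and> 0 \<le> y" by blast
  qed (use x in auto)
  then have "(poly p x)\<^sup>2 \<le> (poly p 1)\<^sup>2 * exp (2 * \<epsilon> - 2 * \<epsilon> * x)"
    by (simp add: g_def exp_diff field_simps)
  also have "\<dots> \<le> (poly p 1)\<^sup>2 * exp (4 * \<epsilon>)"
  proof -
    have "\<epsilon> * (-1) \<le> \<epsilon> * x" using x \<open>\<epsilon> \<ge> 0\<close> by (intro mult_left_mono) auto
    then show ?thesis by (intro mult_left_mono) auto
  qed
  also have "\<dots> = (exp (2 * \<epsilon>) * \<bar>poly p 1\<bar>)\<^sup>2"
    by (simp add: power_mult_distrib flip: exp_double)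
  finally have "\<bar>poly p x\<bar>\<^sup>2 \<le> (exp (2 * \<epsilon>) * \<bar>poly p 1\<bar>)\<^sup>2"
    unfolding power2_abs .
  then show ?thesis
    by (rule power2_le_imp_le) simp
qed

text \<open>
  The derivative of \<open>p\<close> is at most \<open>C\<close> on \<open>[-1, 1]\<close>, so by the extremal growth of the Chebyshev
  polynomials \<open>p\<close> cannot fall from \<open>p 1\<close> to \<open>0\<close> before \<open>a\<close> unless \<open>C\<close> is large enough.
\<close>

lemma log_deriv_lower_bound:
  fixes p :: "real poly"
  assumes "m \<ge> 1" "a > 1" "degree p \<le> m + 2" "poly p a = 0" "poly p 1 \<noteq> 0" "\<epsilon> \<ge> 0"
    and bound: "\<And>x. x \<in> {-1..1} \<Longrightarrow> \<bar>poly (pderiv p) x\<bar> \<le> \<epsilon> * \<bar>poly p x\<bar>"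
  shows "2 * real (m + 2) / (poly (Chebyshev_T (m + 2)) a - poly (Chebyshev_T m) a)
    \<le> \<epsilon> * exp (2 * \<epsilon>)"
proof -
  define C where "C = \<epsilon> * exp (2 * \<epsilon>) * \<bar>poly p 1\<bar>"
  define S where "S = smult (1 / real (m + 2)) (Chebyshev_T (m + 2)) - smult (1 / real m) (Chebyshev_T m)"
  define d where "d = poly (Chebyshev_T (m + 2)) a - poly (Chebyshev_T m) a"
  have "d > 0" using Chebyshev_T_gap_pos[OF \<open>a > 1\<close>, of m] by (simp add: d_def)
  have "C \<ge> 0" using assms by (simp add: C_def)
  have on_I: "\<bar>poly (pderiv p) x\<bar> \<le> C" if "x \<in> {-1..1}" for x
  proof -
    have "\<bar>poly (pderiv p) x\<bar> \<le> \<epsilon> * \<bar>poly p x\<bar>" using bound that .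
    also have "\<dots> \<le> \<epsilon> * (exp (2 * \<epsilon>) * \<bar>poly p 1\<bar>)"
      using abs_le_of_log_deriv_bound[OF bound that] \<open>\<epsilon> \<ge> 0\<close> by (intro mult_left_mono) auto
    finally show ?thesis by (simp add: C_def)
  qed
  have growth: "\<bar>poly (pderiv p) x\<bar> \<le> C * poly (Chebyshev_T (m + 1)) x" if "x \<ge> 1" for x
    using that assms(3) on_I by (intro Chebyshev_T_dominates) (auto simp: degree_pderiv)
  \<comment> \<open>\<open>C S / 2\<close> is an antiderivative of the majorant of \<open>\<bar>p'\<bar>\<close>; both signs \<open>s\<close> are needed, as
    the sign of \<open>p 1\<close> is unknown.\<close>
  have mono: "poly (smult (C / 2) S + smult s p) 1 \<le> poly (smult (C / 2) S + smult s p) a"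
    if "\<bar>s\<bar> = 1" for s
  proof (rule DERIV_nonneg_imp_nondecreasing[where f = "poly (smult (C / 2) S + smult s p)"])
    fix x assume "1 \<le> x" "x \<le> a"
    have "poly (pderiv (smult (C / 2) S + smult s p)) x
        = C * poly (Chebyshev_T (m + 1)) x + s * poly (pderiv p) x"
      using pderiv_Chebyshev_T_diff[OF \<open>m \<ge> 1\<close>]
      by (simp add: pderiv_add pderiv_smult S_def)
    moreover have "\<bar>s * poly (pderiv p) x\<bar> = \<bar>poly (pderiv p) x\<bar>"
      using that by (simp add: abs_mult)
    ultimately have "0 \<le> poly (pderiv (smult (C / 2) S + smult s p)) x"
      using growth[OF \<open>1 \<le> x\<close>] by linarith
    then show "\<exists>y. (poly (smult (C / 2) S + smult s p) has_real_derivative y) (at x) \<and> 0 \<le> y"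
      using poly_DERIV by blast
  qed (use \<open>a > 1\<close> in auto)
  \<comment> \<open>Replacing the weight \<open>1 / m\<close> of \<open>T\<^bsub>m\<^esub>\<close> by \<open>1 / (m + 2)\<close> only increases \<open>S(a) - S(1)\<close>,
    since \<open>T\<^bsub>m\<^esub>(a) \<ge> T\<^bsub>m\<^esub>(1)\<close>.\<close>
  have S_diff: "poly S a - poly S 1 \<le> d / real (m + 2)"
  proof -
    have "d / real (m + 2) - (poly S a - poly S 1)
        = (1 / real m - 1 / real (m + 2)) * (poly (Chebyshev_T m) a - 1)"
      by (simp add: S_def d_def Chebyshev_T_at_1 diff_divide_distrib algebra_simps del: of_nat_add)
    also have "\<dots> \<ge> 0"
      using \<open>m \<ge> 1\<close> \<open>a > 1\<close> Chebyshev_T_ge_1[of a m]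
      by (intro mult_nonneg_nonneg) (auto simp: field_simps)
    finally show ?thesis by simp
  qed
  have "s * poly p 1 \<le> C / 2 * (poly S a - poly S 1)" if "\<bar>s\<bar> = 1" for s
    using mono[OF that] \<open>poly p a = 0\<close> by (simp add: algebra_simps)
  from this[of 1] this[of "-1"] have "\<bar>poly p 1\<bar> \<le> C / 2 * (poly S a - poly S 1)"
    by auto
  also have "\<dots> \<le> C / 2 * (d / real (m + 2))"
    using S_diff \<open>C \<ge> 0\<close> by (intro mult_left_mono) auto
  finally have "1 * \<bar>poly p 1\<bar> \<le> (\<epsilon> * exp (2 * \<epsilon>) * d / (2 * real (m + 2))) * \<bar>poly p 1\<bar>"
    by (simp add: C_def algebra_simps)
  then have "1 \<le> \<epsilon> * exp (2 * \<epsilon>) * d / (2 * real (m + 2))"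
    using \<open>poly p 1 \<noteq> 0\<close> by (subst (asm) mult_le_cancel_right) auto
  then show ?thesis
    using \<open>d > 0\<close> unfolding d_def[symmetric] by (simp add: field_simps)
qed

section \<open>Symmetric pole sets and real polynomials\<close>

definition complex_roots :: "real poly \<Rightarrow> complex multiset" where
  "complex_roots p = proots (map_poly of_real p)"

lemma poly_map_poly_of_real:
  "poly (map_poly complex_of_real p) (of_real x) = of_real (poly p x)"
  by (induction p) (auto simp: map_poly_pCons)

lemma pderiv_map_poly_of_real:
  "pderiv (map_poly complex_of_real p) = map_poly of_real (pderiv p)"
  by (intro poly_eqI) (simp add: coeff_map_poly coeff_pderiv)

lemma map_poly_of_real_nonzero: "p \<noteq> 0 \<Longrightarrow> map_poly complex_of_real p \<noteq> 0"
  by (simp add: map_poly_eq_0_iff)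

lemma map_poly_cnj_linear_product:
  "map_poly cnj (\<Prod>w\<in>#Z. [:-w, 1:]) = (\<Prod>w\<in>#image_mset cnj Z. [:-w, 1:])"
  unfolding poly_eq_poly_eq_iff[symmetric]
  by (rule ext, induction Z) (simp_all add: poly_prod_mset algebra_simps)

lemma linear_product_nonzero: "(\<Prod>w\<in>#Z. [:-w, 1:]) \<noteq> (0 :: complex poly)"
  by (auto simp: prod_mset_zero_iff)

lemma proots_linear_product: "proots (\<Prod>w\<in>#Z. [:-w, 1:]) = (Z :: complex multiset)"
proof (induction Z)
  case (add w Z)
  have "proots ([:-w, 1:] * (\<Prod>v\<in>#Z. [:-v, 1:])) = {#w#} + proots (\<Prod>v\<in>#Z. [:-v, 1:])"
    by (subst proots_mult) (use linear_product_nonzero[of Z] in \<open>auto simp del: mult_pCons_left\<close>)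
  with add show ?case by simp
qed simp

lemma of_real_in_complex_roots_iff:
  assumes "p \<noteq> 0"
  shows "complex_of_real x \<in># complex_roots p \<longleftrightarrow> poly p x = 0"
  using map_poly_of_real_nonzero[OF assms] by (simp add: complex_roots_def poly_map_poly_of_real)

lemma size_complex_roots: "size (complex_roots p) = degree p"
  by (simp add: complex_roots_def size_proots_complex degree_map_poly)

text \<open>
  Conjugating the factorisation into linear factors of a polynomial with real coefficients
  reproduces the polynomial, so the conjugated roots are again its roots.
\<close>

lemma cnj_complex_roots: "image_mset cnj (complex_roots p) = complex_roots p"
proof (cases "p = 0")
  case True
  then show ?thesis by (simp add: complex_roots_def)
next
  case False
  define P where "P = map_poly complex_of_real p"
  define c where "c = lead_coeff P"
  have "c \<noteq> 0" using map_poly_of_real_nonzero[OF False] by (simp add: c_def P_def)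
  have P: "P = smult c (\<Prod>w\<in>#proots P. [:-w, 1:])"
    unfolding c_def by (rule complex_poly_decompose_multiset [symmetric])
  have "P = map_poly cnj P"
    by (intro poly_eqI) (simp add: P_def coeff_map_poly)
  also have "\<dots> = smult (cnj c) (map_poly cnj (\<Prod>w\<in>#proots P. [:-w, 1:]))"
    by (subst P) (rule map_poly_smult, auto)
  also have "\<dots> = smult (cnj c) (\<Prod>w\<in>#image_mset cnj (proots P). [:-w, 1:])"
    unfolding map_poly_cnj_linear_product ..
  finally have "proots P = proots (smult (cnj c) (\<Prod>w\<in>#image_mset cnj (proots P). [:-w, 1:]))"
    by (rule arg_cong)
  also have "\<dots> = image_mset cnj (proots P)"
    using \<open>c \<noteq> 0\<close> by (simp add: proots_linear_product del: image_mset.compositionality)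
  finally show ?thesis by (simp add: complex_roots_def P_def)
qed

text \<open>
  Every symmetric multiset of poles is the root multiset of a real polynomial: conjugation fixes
  the monic polynomial with these roots, so its coefficients are real.
\<close>

lemma cnj_symmetric_imp_complex_roots:
  assumes "image_mset cnj Z = Z"
  obtains p where "p \<noteq> 0" "Z = complex_roots p"
proof -
  define P where "P = (\<Prod>w\<in>#Z. [:-w, 1:])"
  define p where "p = map_poly Re P"
  have "map_poly cnj P = P"
    using assms by (simp only: P_def map_poly_cnj_linear_product)
  then have "cnj (coeff P i) = coeff P i" for i
    by (metis coeff_map_poly complex_cnj_zero)
  then have P: "map_poly of_real p = P"
    by (intro poly_eqI) (simp add: p_def coeff_map_poly complex_eq_iff)
  have "p \<noteq> 0" using linear_product_nonzero[of Z] P by (auto simp: P_def)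
  moreover have "Z = complex_roots p"
    unfolding complex_roots_def P by (simp only: P_def proots_linear_product)
  ultimately show ?thesis by (rule that)
qed

lemma log_deriv_complex_roots:
  assumes "poly p x \<noteq> 0"
  shows "log_deriv (complex_roots p) (of_real x) = of_real (poly (pderiv p) x / poly p x)"
proof -
  define P where "P = map_poly complex_of_real p"
  define c where "c = lead_coeff P"
  define Q where "Q = (\<Prod>w\<in>#complex_roots p. [:-w, 1:])"
  have P: "P = smult c Q"
    unfolding c_def Q_def complex_roots_def P_def by (rule complex_poly_decompose_multiset [symmetric])
  have "p \<noteq> 0" using assms by auto
  then have "of_real x \<notin># complex_roots p" "c \<noteq> 0"
    using assms map_poly_of_real_nonzero[of p]
    by (simp_all add: of_real_in_complex_roots_iff c_def P_def)
  then have "log_deriv (complex_roots p) (of_real x) = poly (pderiv P) (of_real x) / poly P (of_real x)"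
    using log_deriv_eq_pderiv_div[of "of_real x" "complex_roots p"]
    by (simp add: P pderiv_smult flip: Q_def)
  then show ?thesis
    by (simp add: P_def pderiv_map_poly_of_real poly_map_poly_of_real)
qed

text \<open>
  In this form the norm is a statement about real polynomials, in which no division occurs.
\<close>

lemma log_deriv_norm_le_iff:
  assumes "p \<noteq> 0"
  shows "log_deriv_norm (complex_roots p) \<le> ereal \<epsilon> \<longleftrightarrow>
    (\<forall>x\<in>{-1..1}. poly p x \<noteq> 0 \<and> \<bar>poly (pderiv p) x\<bar> \<le> \<epsilon> * \<bar>poly p x\<bar>)"
proof (cases "\<exists>x\<in>{-1..1}. poly p x = 0")
  case True
  then have "log_deriv_norm (complex_roots p) = \<infinity>"
    by (simp add: log_deriv_norm_def of_real_in_complex_roots_iff[OF assms])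
  with True show ?thesis by auto
next
  case False
  then have "log_deriv_norm (complex_roots p)
      = (SUP x\<in>{-1..1}. ereal (cmod (log_deriv (complex_roots p) (of_real x))))"
    by (simp add: log_deriv_norm_def of_real_in_complex_roots_iff[OF assms])
  also have "\<dots> = (SUP x\<in>{-1..1}. ereal (\<bar>poly (pderiv p) x\<bar> / \<bar>poly p x\<bar>))"
    using False by (intro SUP_cong refl) (simp add: log_deriv_complex_roots norm_divide)
  finally show ?thesis
    using False by (auto simp: SUP_le_iff pos_divide_le_eq)
qed

lemma log_deriv_norm_nonneg: "log_deriv_norm Z \<ge> 0"
proof -
  have "0 \<le> ereal (cmod (log_deriv Z (of_real 0)))" by simp
  also have "\<dots> \<le> (SUP x\<in>{-1..1}. ereal (cmod (log_deriv Z (of_real x))))"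
    by (rule SUP_upper) auto
  finally show ?thesis by (simp add: log_deriv_norm_def)
qed


section \<open>Bounds for the least deviation\<close>

lemma log_deriv_class_eq:
  "log_deriv_class n a = complex_roots ` {p. p \<noteq> 0 \<and> degree p \<le> n \<and> poly p a = 0}"
proof (intro equalityI subsetI)
  fix Z assume Z: "Z \<in> log_deriv_class n a"
  then obtain p where "p \<noteq> 0" "Z = complex_roots p"
    by (auto simp: log_deriv_class_def elim: cnj_symmetric_imp_complex_roots)
  then show "Z \<in> complex_roots ` {p. p \<noteq> 0 \<and> degree p \<le> n \<and> poly p a = 0}"
    using Z by (auto simp: log_deriv_class_def size_complex_roots of_real_in_complex_roots_iff)
qed (auto simp: log_deriv_class_def size_complex_roots of_real_in_complex_roots_iff cnj_complex_roots)

lemma least_deviating_norm_le: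
  assumes "least_deviating n a Z" "p \<noteq> 0" "degree p \<le> n" "poly p a = 0"
    and "\<And>x. x \<in> {-1..1} \<Longrightarrow> poly p x \<noteq> 0 \<and> \<bar>poly (pderiv p) x\<bar> \<le> \<epsilon> * \<bar>poly p x\<bar>"
  shows "log_deriv_norm Z \<le> ereal \<epsilon>"
proof -
  have "log_deriv_norm Z \<le> log_deriv_norm (complex_roots p)"
    using assms(1-4) by (auto simp: least_deviating_def log_deriv_class_eq)
  also have "\<dots> \<le> ereal \<epsilon>"
    using assms(2,5) by (simp add: log_deriv_norm_le_iff)
  finally show ?thesis .
qed

text \<open>
  The competitor with the single pole \<open>a\<close>.  The bound is crude but available for every \<open>n\<close>.
\<close>

lemma least_deviating_norm_le_linear:
  assumes "least_deviating n a Z" "n \<ge> 1" "a > 1"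
  shows "log_deriv_norm Z \<le> ereal (1 / (a - 1))"
proof (rule least_deviating_norm_le[where p = "[:-a, 1:]"])
  fix x :: real assume "x \<in> {-1..1}"
  then show "poly [:-a, 1:] x \<noteq> 0 \<and>
      \<bar>poly (pderiv [:-a, 1:]) x\<bar> \<le> 1 / (a - 1) * \<bar>poly [:-a, 1:] x\<bar>"
    using \<open>a > 1\<close> by (auto simp: pderiv_pCons field_simps)
qed (use assms in auto)

text \<open>
  The competitor is the polynomial whose derivative is a multiple of \<open>T\<^bsub>m+1\<^esub>\<close>, the polynomial that
  is extremal in the lower bound.  The number \<open>D / (m + 2)\<close> is \<open>S(a)\<close> minus the
  trivial bound \<open>1 / (m + 2) + 1 / m\<close> for \<open>\<bar>S\<bar>\<close> on \<open>[-1, 1]\<close>.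
\<close>

lemma least_deviating_norm_le_Chebyshev:
  fixes a :: real and m :: nat
  defines "D \<equiv> poly (Chebyshev_T (m + 2)) a
    - real (m + 2) / real m * poly (Chebyshev_T m) a - 2 * real (m + 1) / real m"
  assumes ld: "least_deviating (m + 2) a Z" and "m \<ge> 1" "D > 0"
  shows "log_deriv_norm Z \<le> ereal (2 * real (m + 2) / D)"
proof -
  define S where "S = smult (1 / real (m + 2)) (Chebyshev_T (m + 2)) - smult (1 / real m) (Chebyshev_T m)"
  define p where "p = [:poly S a:] - S"
  have p': "\<bar>poly (pderiv p) x\<bar> \<le> 2" if "x \<in> {-1..1}" for x
    using pderiv_Chebyshev_T_diff[OF \<open>m \<ge> 1\<close>] abs_Chebyshev_T_le_1[OF that, of "m + 1"]
    by (simp add: p_def S_def pderiv_diff abs_mult)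
  have p_ge: "poly p x \<ge> D / real (m + 2)" if "x \<in> {-1..1}" for x
  proof -
    have "poly S x \<le> 1 / real (m + 2) + 1 / real m"
    proof -
      have "poly (Chebyshev_T (m + 2)) x \<le> 1" "- poly (Chebyshev_T m) x \<le> 1"
        using abs_Chebyshev_T_le_1[OF that, of "m + 2"] abs_Chebyshev_T_le_1[OF that, of m] by linarith+
      then have "poly (Chebyshev_T (m + 2)) x / real (m + 2) + (- poly (Chebyshev_T m) x) / real m
          \<le> 1 / real (m + 2) + 1 / real m"
        by (intro add_mono divide_right_mono) auto
      then show ?thesis by (simp add: S_def)
    qed
    moreover have "poly S a - (1 / real (m + 2) + 1 / real m) = D / real (m + 2)"
    proof -
      have identity: "1 / n * u - 1 / k * w - (1 / n + 1 / k) = (u - n / k * w - 2 * j / k) / n"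
        if "k > 0" "n = k + 2" "j = k + 1" for k n j u w :: real
        using that by (simp add: divide_simps)
      show ?thesis
        unfolding S_def D_def poly_diff poly_smult
        by (rule identity) (use \<open>m \<ge> 1\<close> in auto)
    qed
    ultimately show ?thesis by (simp add: p_def)
  qed
  have pos: "D / real (m + 2) > 0" using \<open>D > 0\<close> by simp
  show ?thesis
  proof (rule least_deviating_norm_le[OF ld, of p])
    show "p \<noteq> 0" using p_ge[of 0] pos by auto
    have "degree S \<le> m + 2"
      using degree_Chebyshev_T_le[of m] degree_Chebyshev_T_le[of "m + 2"]
      unfolding S_def by (intro degree_diff_le order.trans[OF degree_smult_le]) auto
    then show "degree p \<le> m + 2"
      unfolding p_def by (intro degree_diff_le) auto
    show "poly p a = 0" by (simp add: p_def)
    fix x :: real assume x: "x \<in> {-1..1}"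
    have "2 * n / D * (D / n) = 2" if "n > 0" for n :: real
      using that \<open>D > 0\<close> by simp
    then have "\<bar>poly (pderiv p) x\<bar> \<le> 2 * real (m + 2) / D * (D / real (m + 2))"
      using p'[OF x] by (metis of_nat_0_less_iff add_gr_0 zero_less_numeral)
    also have "\<dots> \<le> 2 * real (m + 2) / D * \<bar>poly p x\<bar>"
      using p_ge[OF x] \<open>D > 0\<close> by (intro mult_left_mono) auto
    finally show "poly p x \<noteq> 0 \<and> \<bar>poly (pderiv p) x\<bar> \<le> 2 * real (m + 2) / D * \<bar>poly p x\<bar>"
      using p_ge[OF x] pos by auto
  qed
qed

lemma least_deviating_norm_ge:
  assumes ld: "least_deviating (m + 2) a Z" and "m \<ge> 1" "a > 1" and norm: "log_deriv_norm Z = ereal \<epsilon>"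
  shows "2 * real (m + 2) / (poly (Chebyshev_T (m + 2)) a - poly (Chebyshev_T m) a) \<le> \<epsilon> * exp (2 * \<epsilon>)"
proof -
  obtain p where p: "p \<noteq> 0" "degree p \<le> m + 2" "poly p a = 0" "Z = complex_roots p"
    using ld by (auto simp: least_deviating_def log_deriv_class_eq)
  have bound: "poly p x \<noteq> 0 \<and> \<bar>poly (pderiv p) x\<bar> \<le> \<epsilon> * \<bar>poly p x\<bar>" if "x \<in> {-1..1}" for x
    using log_deriv_norm_le_iff[OF p(1), of \<epsilon>] norm that by (simp add: p(4))
  have "\<epsilon> \<ge> 0" using log_deriv_norm_nonneg[of Z] norm by simp
  then show ?thesis
    using bound p assms(2,3) by (intro log_deriv_lower_bound[of m a p]) auto
qed

section \<open>Asymptotics\<close>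

lemma cosh_gap_reciprocal_tendsto_0:
  assumes "t > (0::real)"
  shows "(\<lambda>m. 2 * real (m + 2) / (cosh (real (m + 2) * t) - cosh (real m * t))) \<longlonglongrightarrow> 0"
  using assms unfolding cosh_field_def by real_asymp

text \<open>
  With \<open>t = arcosh a\<close> this is the quotient of the upper bound for the norm and the scale
  \<open>2 n / (T\<^bsub>n\<^esub>(a) - T\<^bsub>n-2\<^esub>(a))\<close>.  It tends to \<open>1\<close> because
  \<open>cosh (m t) / cosh ((m + 2) t)\<close> tends to \<open>exp (-2 t) < 1\<close>, so the changed coefficient and the
  bounded term are of lower order than the denominator.
\<close>

lemma cosh_gap_ratio_tendsto_1:
  assumes "t > (0::real)"
  shows "(\<lambda>m. (cosh (real (m + 2) * t) - cosh (real m * t)) /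
      (cosh (real (m + 2) * t) - real (m + 2) / real m * cosh (real m * t)
        - 2 * real (m + 1) / real m)) \<longlonglongrightarrow> 1"
  using assms unfolding cosh_field_def by real_asymp

text \<open>
  The index is shifted by two, \<open>n = m + 2\<close>, so that no truncated subtraction occurs.
\<close>

definition deviation_scale :: "real \<Rightarrow> nat \<Rightarrow> real" where
  "deviation_scale a m = 2 * real (m + 2) / (poly (Chebyshev_T (m + 2)) a - poly (Chebyshev_T m) a)"

text \<open>
  The quotient \<open>r\<close> of the norm and the scale has an upper bound \<open>B\<close> that depends on \<open>m\<close> only.
  Two lower bounds come from \<open>exp (-2 \<epsilon>) \<le> r\<close>, where \<open>\<epsilon>\<close> is the norm: inserting
  \<open>\<epsilon> \<le> deviation_scale a m * B m\<close> gives the one that tends to \<open>1\<close>, inserting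
  \<open>\<epsilon> \<le> 1 / (a - 1)\<close> the uniform one.
\<close>

lemma least_deviation_two_sided:
  fixes a :: real
  assumes "a > 1"
  obtains B where "B \<longlonglongrightarrow> 1" and "deviation_scale a \<longlonglongrightarrow> 0"
    and "\<forall>m\<ge>1. \<forall>Z. least_deviating (m + 2) a Z \<longrightarrow>
      (\<exists>r. log_deriv_norm Z / ereal (deviation_scale a m) = ereal r \<and>
        r \<le> B m \<and> exp (- 2 * (deviation_scale a m * B m)) \<le> r \<and> exp (- 2 / (a - 1)) \<le> r)"
proof
  define d where "d m = poly (Chebyshev_T (m + 2)) a - poly (Chebyshev_T m) a" for m
  define D where "D m = poly (Chebyshev_T (m + 2)) a
    - real (m + 2) / real m * poly (Chebyshev_T m) a - 2 * real (m + 1) / real m" for m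
  \<comment> \<open>For small \<open>m\<close> the number \<open>D m\<close> need not be positive, and then only the competitor with the single pole
    \<open>a\<close> is left.\<close>
  define B where "B m = (if D m > 0 then d m / D m else 1 / ((a - 1) * deviation_scale a m))" for m
  have d_pos: "d m > 0" for m
    using Chebyshev_T_gap_pos[OF \<open>a > 1\<close>, of m] by (simp add: d_def)
  have lam: "deviation_scale a m = 2 * real (m + 2) / d m" and lam_pos: "deviation_scale a m > 0" for m
    using d_pos[of m] by (simp_all add: deviation_scale_def d_def)
  have t: "arcosh a > 0" using \<open>a > 1\<close> by simp
  have T: "poly (Chebyshev_T k) a = cosh (real k * arcosh a)" for k
    using \<open>a > 1\<close> by (simp add: poly_Chebyshev_T_arcosh)
  show "deviation_scale a \<longlonglongrightarrow> 0"
    unfolding deviation_scale_def[abs_def] T by (rule cosh_gap_reciprocal_tendsto_0[OF t])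
  have lim: "(\<lambda>m. d m / D m) \<longlonglongrightarrow> 1"
    unfolding d_def D_def T by (rule cosh_gap_ratio_tendsto_1[OF t])
  then have "\<forall>\<^sub>F m in sequentially. d m / D m > 0"
    by (rule order_tendstoD) simp
  then have "\<forall>\<^sub>F m in sequentially. B m = d m / D m"
  proof eventually_elim
    case (elim m)
    then show ?case using d_pos[of m] by (simp add: B_def zero_less_divide_iff)
  qed
  then show "B \<longlonglongrightarrow> 1"
    using lim by (simp cong: tendsto_cong)
  show "\<forall>m\<ge>1. \<forall>Z. least_deviating (m + 2) a Z \<longrightarrow>
      (\<exists>r. log_deriv_norm Z / ereal (deviation_scale a m) = ereal r \<and>
        r \<le> B m \<and> exp (- 2 * (deviation_scale a m * B m)) \<le> r \<and> exp (- 2 / (a - 1)) \<le> r)"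
  proof (intro allI impI)
    fix m Z assume m: "m \<ge> 1" and ld: "least_deviating (m + 2) a Z"
    have le_lin: "log_deriv_norm Z \<le> ereal (1 / (a - 1))"
      using least_deviating_norm_le_linear[OF ld _ \<open>a > 1\<close>] by simp
    then obtain \<epsilon> where \<epsilon>: "log_deriv_norm Z = ereal \<epsilon>"
      using log_deriv_norm_nonneg[of Z] by (cases "log_deriv_norm Z") auto
    define r where "r = \<epsilon> / deviation_scale a m"
    have \<epsilon>_r: "\<epsilon> = deviation_scale a m * r" using lam_pos[of m] by (simp add: r_def)
    have "\<epsilon> \<le> deviation_scale a m * B m"
    proof (cases "D m > 0")
      case True
      then have "\<epsilon> \<le> 2 * real (m + 2) / D m"
        using least_deviating_norm_le_Chebyshev[OF ld m] \<epsilon> by (simp add: D_def)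
      then show ?thesis using True d_pos[of m] by (simp add: B_def lam)
    next
      case False
      then show ?thesis using le_lin \<epsilon> lam_pos[of m] by (simp add: B_def)
    qed
    moreover have "exp (- 2 * \<epsilon>) \<le> r"
    proof -
      have "deviation_scale a m \<le> \<epsilon> * exp (2 * \<epsilon>)"
        using least_deviating_norm_ge[OF ld m \<open>a > 1\<close> \<epsilon>] by (simp add: deviation_scale_def)
      then show ?thesis
        using lam_pos[of m] by (simp add: r_def exp_minus field_simps)
    qed
    moreover have "\<epsilon> \<le> 1 / (a - 1)" using le_lin \<epsilon> by simp
    ultimately have "r \<le> B m" "exp (- 2 * (deviation_scale a m * B m)) \<le> r" "exp (- 2 / (a - 1)) \<le> r"
      using lam_pos[of m] by (auto simp: \<epsilon>_r elim!: order.trans[rotated])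
    moreover have "log_deriv_norm Z / ereal (deviation_scale a m) = ereal r"
      using \<epsilon> lam_pos[of m] by (simp add: r_def)
    ultimately show "\<exists>r. log_deriv_norm Z / ereal (deviation_scale a m) = ereal r \<and>
        r \<le> B m \<and> exp (- 2 * (deviation_scale a m * B m)) \<le> r \<and> exp (- 2 / (a - 1)) \<le> r"
      by blast
  qed
qed

text \<open>
  Every \<open>a > sqrt 2\<close> satisfies the condition for all large \<open>n\<close>, as the \<open>n\<close>-th roots tend to
  \<open>1\<close>.  Hence a family that is least deviating wherever the condition holds is so eventually.
\<close>

lemma eventually_threshold:
  assumes "a > sqrt 2"
  shows "\<forall>\<^sub>F n in sequentially. a > sqrt 2 * root n (3 * sqrt (real n))"
proof -
  have "(\<lambda>n. sqrt 2 * (root n 3 * sqrt (root n (real n)))) \<longlonglongrightarrow> sqrt 2 * (1 * sqrt 1)"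
    by (intro tendsto_intros LIMSEQ_root LIMSEQ_root_const) simp
  then have "\<forall>\<^sub>F n in sequentially. sqrt 2 * (root n 3 * sqrt (root n (real n))) < a"
    using assms by (intro order_tendstoD) auto
  moreover have "root n (3 * sqrt (real n)) = root n 3 * sqrt (root n (real n))" for n
    by (simp add: real_root_mult sqrt_def real_root_commute)
  ultimately show ?thesis by simp
qed

theorem theorem2:
  fixes a :: real
  assumes "a > sqrt 2"
  shows
    "(\<exists>\<alpha> \<beta> :: real. 0 < \<alpha> \<and> \<alpha> \<le> \<beta> \<and>
        (\<forall>(n::nat) Z. n \<ge> 4 \<longrightarrow> a > sqrt 2 * root n (3 * sqrt (real n)) \<longrightarrow>
           least_deviating n a Z \<longrightarrow>
           log_deriv_norm Z /
             ereal (2 * real n / (poly (Chebyshev_T n) a - poly (Chebyshev_T (n - 2)) a))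
           \<in> {ereal \<alpha>..ereal \<beta>}))
     \<and>
     (\<forall>\<rho> :: nat \<Rightarrow> complex multiset.
        (\<forall>n\<ge>4. a > sqrt 2 * root n (3 * sqrt (real n)) \<longrightarrow> least_deviating n a (\<rho> n)) \<longrightarrow>
        (\<lambda>n. log_deriv_norm (\<rho> n) /
               ereal (2 * real n / (poly (Chebyshev_T n) a - poly (Chebyshev_T (n - 2)) a)))
          \<longlonglongrightarrow> 1)"
proof -
  have "a > 1" using assms real_sqrt_gt_1_iff[of 2] by linarith
  obtain B where B: "B \<longlonglongrightarrow> 1" and lam: "deviation_scale a \<longlonglongrightarrow> 0"
    and bounds: "\<forall>m\<ge>1. \<forall>Z. least_deviating (m + 2) a Z \<longrightarrow>
      (\<exists>r. log_deriv_norm Z / ereal (deviation_scale a m) = ereal r \<and>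
        r \<le> B m \<and> exp (- 2 * (deviation_scale a m * B m)) \<le> r \<and> exp (- 2 / (a - 1)) \<le> r)"
    by (rule least_deviation_two_sided[OF \<open>a > 1\<close>])
  obtain K where K: "\<And>m. B m \<le> K"
    using convergent_imp_Bseq[OF convergentI[OF B]] by (auto simp: Bseq_def dest: abs_le_D1)
  show ?thesis
  proof (intro conjI exI allI impI)
    show "0 < exp (- 2 / (a - 1))" by simp
    show "exp (- 2 / (a - 1)) \<le> max (exp (- 2 / (a - 1))) K" by simp
    fix n :: nat and Z assume "n \<ge> 4" and ld: "least_deviating n a Z"
    define m where "m = n - 2"
    have n: "n = m + 2" "m \<ge> 1" using \<open>n \<ge> 4\<close> by (simp_all add: m_def)
    obtain r where "log_deriv_norm Z / ereal (deviation_scale a m) = ereal r" "r \<le> B m" "exp (- 2 / (a - 1)) \<le> r"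
      using bounds n(2) ld[unfolded n(1)] by blast
    then show "log_deriv_norm Z /
        ereal (2 * real n / (poly (Chebyshev_T n) a - poly (Chebyshev_T (n - 2)) a))
      \<in> {ereal (exp (- 2 / (a - 1)))..ereal (max (exp (- 2 / (a - 1))) K)}"
      using K[of m] by (simp add: n(1) deviation_scale_def)
  next
    fix \<rho> :: "nat \<Rightarrow> complex multiset"
    assume \<rho>: "\<forall>n\<ge>4. a > sqrt 2 * root n (3 * sqrt (real n)) \<longrightarrow> least_deviating n a (\<rho> n)"
    have "\<forall>\<^sub>F m in sequentially. a > sqrt 2 * root (m + 2) (3 * sqrt (real (m + 2)))"
      by (rule sequentially_offset[OF eventually_threshold[OF assms]])
    then have ev: "\<forall>\<^sub>F m in sequentially. m \<ge> 2 \<and> least_deviating (m + 2) a (\<rho> (m + 2))"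
      using eventually_ge_at_top[of 2] by eventually_elim (use \<rho> in auto)
    define q where "q m = log_deriv_norm (\<rho> (m + 2)) / ereal (deviation_scale a m)" for m
    have q: "\<forall>\<^sub>F m in sequentially.
        ereal (exp (- 2 * (deviation_scale a m * B m))) \<le> q m \<and> q m \<le> ereal (B m)"
      using ev
    proof eventually_elim
      case (elim m)
      then obtain r where "q m = ereal r" "r \<le> B m" "exp (- 2 * (deviation_scale a m * B m)) \<le> r"
        using bounds[rule_format, of m "\<rho> (m + 2)"] unfolding q_def by force
      then show ?case by simp
    qed
    have "q \<longlonglongrightarrow> 1"
    proof (rule tendsto_sandwich)
      show "\<forall>\<^sub>F m in sequentially. ereal (exp (- 2 * (deviation_scale a m * B m))) \<le> q m"
        using q by (rule eventually_mono) simp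
      show "\<forall>\<^sub>F m in sequentially. q m \<le> ereal (B m)"
        using q by (rule eventually_mono) simp
      have "(\<lambda>m. exp (- 2 * (deviation_scale a m * B m))) \<longlonglongrightarrow> exp (- 2 * (0 * 1))"
        by (intro tendsto_intros lam B)
      then show "(\<lambda>m. ereal (exp (- 2 * (deviation_scale a m * B m)))) \<longlonglongrightarrow> 1"
        by (simp add: one_ereal_def)
      show "(\<lambda>m. ereal (B m)) \<longlonglongrightarrow> 1"
        using B by (simp add: one_ereal_def)
    qed
    then have "(\<lambda>m. log_deriv_norm (\<rho> (m + 2)) / ereal (2 * real (m + 2) /
        (poly (Chebyshev_T (m + 2)) a - poly (Chebyshev_T (m + 2 - 2)) a))) \<longlonglongrightarrow> 1"
      unfolding q_def[abs_def] deviation_scale_def add_diff_cancel_right' .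
    then show "(\<lambda>n. log_deriv_norm (\<rho> n) /
        ereal (2 * real n / (poly (Chebyshev_T n) a - poly (Chebyshev_T (n - 2)) a))) \<longlonglongrightarrow> 1"
      by (rule LIMSEQ_offset)
  qed
qed

end
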